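(* Let $d\ge 2$ and let $G$ be a finite directed graph on the vertex set $\{1,\ldots,d\}$ with arrow set $A(G)$, such that the underlying undirected graph $\widetilde{G}$ is connected and every arrow of $G$ appears in a directed cycle in $G$. Let $\mathcal{P}_G\subset\mathbb{R}^d$ be the convex hull of $\{\mathbf{e}_i-\mathbf{e}_j : (i,j)\in A(G)\}$. Then the following conditions are equivalent: (i) $\mathcal{P}_G$ is simplicial; (ii) $\mathcal{P}_G$ is smooth; (iii) $G$ possesses no homogeneous cycle $C=(\vec{e}_1,\ldots,\vec{e}_l)$, where $\vec{e}_j$ is $(i_j,i_{j+1})$ or $(i_{j+1},i_j)$ for $1\le j\le l$ with $i_{l+1}=i_1$, such that $$\mu_C(i_a)-\mu_C(i_b)\le \mathrm{dist}_G(i_a,i_b)\qquad\text{for all } 1\le a,b\le l.$$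
   Context: Directed graphs: an arrow of $G$ is an ordered pair $(i,j)$ of distinct vertices, and $A(G)$ is the set of arrows; $(i,j)$ and $(j,i)$ are distinct arrows and both may belong to $A(G)$. The undirected graph $\widetilde{G}$ has the same vertex set as $G$ and edge set $\{\{i,j\} : (i,j)\in A(G)\text{ or }(j,i)\in A(G)\}$. Cycles: a cycle in $G$ of length $l$ is a sequence $(i_1,\ldots,i_l)$ of pairwise distinct vertices together with arrows $\vec{e}_1,\ldots,\vec{e}_l\in A(G)$ such that, with $i_{l+1}=i_1$, each $\vec{e}_j$ is either $(i_j,i_{j+1})$ or $(i_{j+1},i_j)$, where either $l\ge 3$ (so that the edges $\{i_j,i_{j+1}\}$ form a cycle of $\widetilde{G}$), or $l=2$ and $\vec{e}_1,\vec{e}_2$ are the two distinct arrows $(i,j)$ and $(j,i)$. It is denoted $C=(\vec{e}_1,\ldots,\vec{e}_l)$. Let $\Delta_C^{(+)}$ be the set of those $\vec{e}_j$ with $\vec{e}_j=(i_j,i_{j+1})$ and $\Delta_C^{(-)}$ the set of the remaining $\vec{e}_j$. The cycle $C$ is homogeneous if $|\Delta_C^{(+)}|=|\Delta_C^{(-)}|$, and is a directed cycle if $\Delta_C^{(+)}=\emptyset$ or $\Delta_C^{(-)}=\emptyset$. (In particular the two arrows $(i,j),(j,i)$ form a directed cycle of length two, which is not homogeneous.) The function $\mu_C$: for a homogeneous cycle $C=(\vec{e}_1,\ldots,\vec{e}_l)$ with pairwise distinct vertices $i_1,\ldots,i_l$, where each $\vec{e}_j$ is either $(i_j,i_{j+1})$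 or $(i_{j+1},i_j)$ for $1\le j\le l$ with $i_{l+1}=i_1$, $\mu_C:\{i_1,\ldots,i_l\}\to\mathbb{Z}_{\ge 0}$ is the unique function such that $\mu_C(i_{j+1})=\mu_C(i_j)-1$ if $\vec{e}_j=(i_j,i_{j+1})$, $\mu_C(i_{j+1})=\mu_C(i_j)+1$ if $\vec{e}_j=(i_{j+1},i_j)$ (for $1\le j\le l$, $i_{l+1}=i_1$), and $\min\{\mu_C(i_1),\ldots,\mu_C(i_l)\}=0$. Distance: for distinct vertices $i,j$, $\mathrm{dist}_G(i,j)$ is the length of a shortest directed path in $G$ from $i$ to $j$, and is $\infty$ if there is no such path; $\mathrm{dist}_G(i,i)=0$. Polytopes: $\mathbf{e}_1,\ldots,\mathbf{e}_d$ is the standard basis of $\mathbb{R}^d$. The polytope $\mathcal{P}_G$ lies in the hyperplane $\mathcal{H}=\{x\in\mathbb{R}^d : x_1+\cdots+x_d=0\}$ and is regarded as a polytope in $\mathcal{H}$ with respect to the lattice $\mathcal{H}\cap\mathbb{Z}^d$ of rank $d-1$. Under the stated hypotheses it has dimension $d-1$ and the origin is its unique lattice point in its (relative) interior. It is simplicial if every facet is a simplex, and smooth if the vertices of each facet form a $\mathbb{Z}$-basis of $\mathcal{H}\cap\mathbb{Z}^d$. *)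

theory Defs
  imports "HOL-Analysis.Analysis"
begin

text \<open>A directed graph whose vertex set is the whole finite type \<open>'n\<close> is given by its
  arrow set \<open>A :: ('n \<times> 'n) set\<close>, assumed irreflexive where it is used.\<close>

definition undirected_edges :: "('n \<times> 'n) set \<Rightarrow> 'n set set" where
  "undirected_edges A = {{i, j} | i j. (i, j) \<in> A \<or> (j, i) \<in> A}"

definition underlying_connected :: "('n \<times> 'n) set \<Rightarrow> bool" where
  "underlying_connected A \<longleftrightarrow>
     (\<forall>i j. (i, j) \<in> {(u, v). {u, v} \<in> undirected_edges A}\<^sup>*)"

text \<open>Positions in a cycle are counted from \<open>0\<close>; the successor of the last one is the first.\<close>

definition next_vertex :: "'n list \<Rightarrow> nat \<Rightarrow> 'n" where
  "next_vertex vs j = vs ! (Suc j mod length vs)"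

definition is_cycle :: "('n \<times> 'n) set \<Rightarrow> 'n list \<Rightarrow> ('n \<times> 'n) list \<Rightarrow> bool" where
  "is_cycle A vs es \<longleftrightarrow>
     length es = length vs \<and> distinct vs \<and> set es \<subseteq> A \<and>
     (\<forall>j < length vs. es ! j = (vs ! j, next_vertex vs j) \<or>
                      es ! j = (next_vertex vs j, vs ! j)) \<and>
     (length vs \<ge> 3 \<or> length vs = 2 \<and> es ! 0 \<noteq> es ! 1)"

definition Delta_plus :: "'n list \<Rightarrow> ('n \<times> 'n) list \<Rightarrow> ('n \<times> 'n) set" where
  "Delta_plus vs es = {es ! j | j. j < length vs \<and> es ! j = (vs ! j, next_vertex vs j)}"

definition Delta_minus :: "'n list \<Rightarrow> ('n \<times> 'n) list \<Rightarrow> ('n \<times> 'n) set" where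
  "Delta_minus vs es = set es - Delta_plus vs es"

definition homogeneous_cycle :: "('n \<times> 'n) set \<Rightarrow> 'n list \<Rightarrow> ('n \<times> 'n) list \<Rightarrow> bool" where
  "homogeneous_cycle A vs es \<longleftrightarrow>
     is_cycle A vs es \<and> card (Delta_plus vs es) = card (Delta_minus vs es)"

definition directed_cycle :: "('n \<times> 'n) set \<Rightarrow> 'n list \<Rightarrow> ('n \<times> 'n) list \<Rightarrow> bool" where
  "directed_cycle A vs es \<longleftrightarrow>
     is_cycle A vs es \<and> (Delta_plus vs es = {} \<or> Delta_minus vs es = {})"

text \<open>The function \<open>\<mu>\<^sub>C\<close> has domain \<open>set vs\<close>; uniqueness refers to functions on this
  domain, hence the extensionality requirement.  It is meaningful only for homogeneous cycles.\<close>

definition cycle_mu :: "'n list \<Rightarrow> ('n \<times> 'n) list \<Rightarrow> 'n \<Rightarrow> nat" where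
  "cycle_mu vs es = (THE \<mu>. \<mu> \<in> extensional (set vs) \<and>
     (\<forall>j < length vs.
        (es ! j = (vs ! j, next_vertex vs j) \<longrightarrow>
           int (\<mu> (next_vertex vs j)) = int (\<mu> (vs ! j)) - 1) \<and>
        (es ! j = (next_vertex vs j, vs ! j) \<longrightarrow>
           int (\<mu> (next_vertex vs j)) = int (\<mu> (vs ! j)) + 1)) \<and>
     Min (\<mu> ` set vs) = 0)"

definition directed_path :: "('n \<times> 'n) set \<Rightarrow> 'n \<Rightarrow> 'n list \<Rightarrow> 'n \<Rightarrow> bool" where
  "directed_path A i p j \<longleftrightarrow>
     p \<noteq> [] \<and> hd p = i \<and> last p = j \<and> distinct p \<and> successively (\<lambda>u v. (u, v) \<in> A) p"

text \<open>The infimum of the empty set is \<open>\<infinity>\<close>, and \<open>[i]\<close> is a path of length \<open>0\<close> from \<open>i\<close> to \<open>i\<close>.\<close>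

definition digraph_dist :: "('n \<times> 'n) set \<Rightarrow> 'n \<Rightarrow> 'n \<Rightarrow> enat" where
  "digraph_dist A i j = Inf {enat (length p - 1) | p. directed_path A i p j}"

definition digraph_polytope :: "('n::finite \<times> 'n) set \<Rightarrow> (real ^ 'n) set" where
  "digraph_polytope A = convex hull {axis i 1 - axis j 1 | i j. (i, j) \<in> A}"

definition zero_sum_lattice :: "(real ^ 'n::finite) set" where
  "zero_sum_lattice = {x. (\<Sum>i\<in>UNIV. x $ i) = 0 \<and> (\<forall>i. x $ i \<in> \<int>)}"

interpretation int_module: module "\<lambda>(k::int) (v::'a::real_vector). of_int k *\<^sub>R v"
  by unfold_locales (simp_all add: algebra_simps)

definition int_basis_of :: "'a::real_vector set \<Rightarrow> 'a set \<Rightarrow> bool" where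
  "int_basis_of B L \<longleftrightarrow> \<not> int_module.dependent B \<and> int_module.span B = L"

definition simplicial_polytope :: "'a::euclidean_space set \<Rightarrow> bool" where
  "simplicial_polytope P \<longleftrightarrow> (\<forall>F. F facet_of P \<longrightarrow> (\<exists>k. k simplex F))"

text \<open>Smoothness is relative to a lattice \<open>L\<close>; \<open>facet_of\<close> is intrinsic to the affine hull
  of \<open>P\<close>, so \<open>P\<close> need not be full-dimensional in the ambient space.\<close>

definition smooth_polytope :: "'a::euclidean_space set \<Rightarrow> 'a set \<Rightarrow> bool" where
  "smooth_polytope L P \<longleftrightarrow>
     (\<forall>F. F facet_of P \<longrightarrow> int_basis_of {v. v extreme_point_of F} L)"

end

theory Submission
  imports Defs
begin

text \<open>
  Write \<open>arrow_vec (i, j)\<close> for \<open>e\<^sub>i - e\<^sub>j\<close>.  A linear functional \<open>a\<close> takes the value \<open>a\<^sub>i - a\<^sub>j\<close>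
  there, so it is at most \<open>1\<close> on the polytope exactly when \<open>a\<close>, read as a function on the
  vertices, drops by at most \<open>1\<close> along every arrow.  The hypotheses make the digraph strongly
  connected (\<open>strongly_connected\<close>), and then every facet is the face \<open>a = 1\<close> of such a functional
  (\<open>facet_is_level_face\<close>).  All arrow vectors are vertices of the polytope, so the vertices of this
  face are the vectors of the tight arrows, those along which \<open>a\<close> drops by exactly \<open>1\<close>.

  For a facet the tight arrows connect all the vertices (\<open>facet_tight_connected\<close>), hence their
  vectors generate the lattice over the integers (\<open>int_span_connected\<close>).  If the tight arrows
  contain no undirected cycle, they form a spanning tree, their vectors are linearly independent,
  and the facet is a simplex whose vertices form a lattice basis.  If they contain a cycle, then
  on this cycle \<open>a\<close> changes by one at every step; so the cycle is homogeneous, its function \<open>\<mu>\<close>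
  is \<open>a\<close> up to a constant, and adding up drops along a shortest path gives
  \<open>\<mu> u - \<mu> v \<le> dist u v\<close> (\<open>tight_cycle_distance_bounded\<close>).

  Conversely, if the function \<open>\<mu>\<close> of a homogeneous cycle is bounded by the distance in this way, it
  extends to a function on all the vertices that drops by at most \<open>1\<close> along arrows
  (\<open>subpotential_extension\<close>, the McShane extension for the directed distance).  It cuts out
  a proper face containing the vectors of the cycle.  These satisfy a linear relation with
  coefficients \<open>1\<close> and \<open>-1\<close>, and homogeneity makes the coefficients add up to zero.  So any facet
  around this face has affinely dependent vertices: it is neither a simplex, nor do its vertices
  form a lattice basis (\<open>bad_facet_if_bounded_cycle\<close>).  Thus one and the same condition on cycles
  decides both the simplicial and the smooth case.
\<close>

section \<open>Arrow vectors\<close>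

definition arrow_vec :: "'n \<times> 'n \<Rightarrow> real ^ 'n::finite" where
  "arrow_vec e = axis (fst e) 1 - axis (snd e) 1"

lemma arrow_vec_Pair: "arrow_vec (i, j) = axis i 1 - axis j 1"
  by (simp add: arrow_vec_def)

lemma inner_arrow_vec [simp]: "a \<bullet> arrow_vec e = a $ fst e - a $ snd e"
  by (simp add: arrow_vec_def inner_diff_right inner_axis)

lemma digraph_polytope_eq: "digraph_polytope A = convex hull (arrow_vec ` A)"
proof -
  have "{axis i 1 - axis j 1 | i j. (i, j) \<in> A} = arrow_vec ` A"
    by (force simp: arrow_vec_def image_iff)
  then show ?thesis by (simp add: digraph_polytope_def)
qed

lemma inj_on_arrow_vec:
  assumes "irrefl A"
  shows "inj_on arrow_vec A"
proof (rule inj_onI, clarify)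
  fix i j k l assume *: "(i, j) \<in> A" "(k, l) \<in> A" "arrow_vec (i, j) = arrow_vec (k, l)"
  then have ne: "i \<noteq> j" "k \<noteq> l" using assms by (auto simp: irrefl_def)
  have "arrow_vec (i, j) $ i = arrow_vec (k, l) $ i" "arrow_vec (i, j) $ j = arrow_vec (k, l) $ j"
    using * by simp_all
  then show "i = k \<and> j = l" using ne
    by (auto simp: arrow_vec_def axis_def split: if_splits)
qed

section \<open>Cycles and their potentials\<close>

lemma next_vertex_last:
  "length vs = Suc m \<Longrightarrow> next_vertex vs m = vs ! 0"
  by (simp add: next_vertex_def)

lemma next_vertex_Suc:
  "Suc k < length vs \<Longrightarrow> next_vertex vs k = vs ! Suc k"
  by (simp add: next_vertex_def)

lemma sum_next_vertex:
  fixes f :: "'n \<Rightarrow> 'b::comm_monoid_add"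
  shows "(\<Sum>k<length vs. f (next_vertex vs k)) = (\<Sum>k<length vs. f (vs ! k))"
proof (cases "length vs")
  case (Suc m)
  have "(\<Sum>k<length vs. f (next_vertex vs k)) = (\<Sum>k<m. f (vs ! Suc k)) + f (vs ! 0)"
    using Suc by (simp add: next_vertex_last next_vertex_Suc cong: sum.cong_simp)
  also have "\<dots> = (\<Sum>k<length vs. f (vs ! k))"
    by (simp only: Suc sum.lessThan_Suc_shift add.commute)
  finally show ?thesis .
qed simp

lemma next_vertex_in_set: "k < length vs \<Longrightarrow> next_vertex vs k \<in> set vs"
  unfolding next_vertex_def by (intro nth_mem mod_less_divisor) auto

lemma next_vertex_neq:
  assumes "is_cycle A vs es" "k < length vs"
  shows "next_vertex vs k \<noteq> vs ! k"
proof -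
  have "length vs \<ge> 2" "distinct vs" using assms by (auto simp: is_cycle_def)
  moreover have "Suc k mod length vs \<noteq> k"
    using calculation assms by (cases "Suc k = length vs") auto
  moreover have "Suc k mod length vs < length vs" using assms(2) by (intro mod_less_divisor) linarith
  ultimately show ?thesis
    using assms(2) unfolding next_vertex_def by (simp add: nth_eq_iff_index_eq)
qed

text \<open>For length at least three, two positions with the same arrow would each be the successor of the
  other; for length two, distinctness is part of what a cycle is.  It allows the arrows of a cycle to be
  counted by their positions.\<close>

lemma cycle_arrows_distinct:
  assumes "is_cycle A vs es"
  shows "distinct es"
  unfolding distinct_conv_nth
proof (intro allI impI)
  fix j k assume jk: "j < length es" "k < length es" "j \<noteq> k"
  define l where "l = length vs"
  have l: "length es = l" "l \<ge> 2" "distinct vs" "l \<ge> 3 \<or> l = 2 \<and> es ! 0 \<noteq> es ! 1"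
    and es: "\<And>j. j < l \<Longrightarrow> es ! j = (vs ! j, next_vertex vs j) \<or> es ! j = (next_vertex vs j, vs ! j)"
    using assms by (auto simp: is_cycle_def l_def)
  show "es ! j \<noteq> es ! k"
  proof (cases "l = 2")
    case True
    then have "j = 0 \<and> k = 1 \<or> j = 1 \<and> k = 0" using jk l by auto
    then show ?thesis using l True by auto
  next
    case False
    then have l3: "l \<ge> 3" using l by simp
    show ?thesis
    proof
      assume eq: "es ! j = es ! k"
      have jk': "j < l" "k < l" using jk l by simp_all
      have "vs ! j \<noteq> vs ! k" using jk jk' l by (simp add: l_def nth_eq_iff_index_eq)
      then have "vs ! j = next_vertex vs k" "vs ! k = next_vertex vs j"
        using es[OF jk'(1)] es[OF jk'(2)] eq by auto
      moreover have "Suc k mod l < l" "Suc j mod l < l"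
        using l3 by (intro mod_less_divisor; simp)+
      moreover have index: "a = b" if "a < l" "b < l" "vs ! a = vs ! b" for a b
        using that l(3) by (simp add: nth_eq_iff_index_eq l_def)
      ultimately have step: "j = Suc k mod l" "k = Suc j mod l"
        unfolding next_vertex_def l_def[symmetric] by (blast intro: index jk')+
      have "j = Suc k \<or> Suc k = l \<and> j = 0"
        using step(1) jk'(2) by (cases "Suc k = l") simp_all
      moreover have "k = Suc j \<or> Suc j = l \<and> k = 0"
        using step(2) jk'(1) by (cases "Suc j = l") simp_all
      ultimately show False using l3 by (elim disjE conjE) linarith+
    qed
  qed
qed

definition cycle_sign :: "'n list \<Rightarrow> ('n \<times> 'n) list \<Rightarrow> nat \<Rightarrow> int" where
  "cycle_sign vs es k = (if es ! k = (vs ! k, next_vertex vs k) then 1 else - 1)"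

lemma homogeneous_cycle_iff_sum:
  assumes "is_cycle A vs es"
  shows "homogeneous_cycle A vs es \<longleftrightarrow> (\<Sum>k<length vs. cycle_sign vs es k) = 0"
proof -
  let ?l = "length vs"
  define P where "P = {k. k < ?l \<and> es ! k = (vs ! k, next_vertex vs k)}"
  have len: "length es = ?l" using assms by (simp add: is_cycle_def)
  have inj: "inj_on ((!) es) {..<?l}"
    using cycle_arrows_distinct[OF assms] len by (auto simp: inj_on_def nth_eq_iff_index_eq)
  have P: "P \<subseteq> {..<?l}" "finite P" by (auto simp: P_def)
  have plus: "Delta_plus vs es = (!) es ` P" 
    unfolding Delta_plus_def P_def by blast
  have "set es = (!) es ` {..<?l}" using len by (auto simp: set_conv_nth)
  then have minus: "Delta_minus vs es = (!) es ` ({..<?l} - P)"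
    unfolding Delta_minus_def plus by (simp add: inj_on_image_set_diff[OF inj] P)
  have "card (Delta_plus vs es) = card P" unfolding plus
    by (rule card_image[OF inj_on_subset[OF inj P(1)]])
  moreover have "card (Delta_minus vs es) = card ({..<?l} - P)" unfolding minus
    by (rule card_image[OF inj_on_subset[OF inj]]) auto
  moreover have "(\<Sum>k<?l. cycle_sign vs es k) = int (card P) - int (card ({..<?l} - P))"
  proof -
    have "(\<Sum>k<?l. cycle_sign vs es k) = sum (cycle_sign vs es) ({..<?l} - P) + sum (cycle_sign vs es) P"
      by (rule sum.subset_diff) (use P in auto)
    moreover have "sum (cycle_sign vs es) P = int (card P)"
      by (simp add: P_def cycle_sign_def)
    moreover have "sum (cycle_sign vs es) ({..<?l} - P) = (\<Sum>k\<in>{..<?l} - P. - 1)"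
      by (rule sum.cong) (auto simp: P_def cycle_sign_def)
    ultimately show ?thesis by simp
  qed
  ultimately show ?thesis using assms by (simp add: homogeneous_cycle_def)
qed

text \<open>The step conditions on \<open>\<mu>\<^sub>C\<close>, without the normalisation of its minimum, for real-valued
  functions: then \<open>\<mu>\<^sub>C\<close> can be compared with the functionals that cut out faces.\<close>

definition cycle_potential :: "'n list \<Rightarrow> ('n \<times> 'n) list \<Rightarrow> ('n \<Rightarrow> real) \<Rightarrow> bool" where
  "cycle_potential vs es f \<longleftrightarrow>
     (\<forall>k<length vs. f (vs ! k) - f (next_vertex vs k) = of_int (cycle_sign vs es k))"

lemma cycle_potential_diff_unique:
  assumes "cycle_potential vs es f" "cycle_potential vs es g" "u \<in> set vs" "v \<in> set vs"
  shows "f u - f v = g u - g v"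
proof -
  have base: "f (vs ! k) - f (vs ! 0) = g (vs ! k) - g (vs ! 0)" if "k < length vs" for k
    using that
  proof (induction k)
    case (Suc k)
    have *: "next_vertex vs k = vs ! Suc k" using Suc.prems by (simp add: next_vertex_def)
    have "f (vs ! k) - f (next_vertex vs k) = g (vs ! k) - g (next_vertex vs k)"
      using assms(1,2) Suc.prems by (auto simp: cycle_potential_def)
    then show ?case using Suc by (simp add: *)
  qed simp
  from assms obtain a b where "a < length vs" "u = vs ! a" "b < length vs" "v = vs ! b"
    by (metis in_set_conv_nth)
  then show ?thesis using base[of a] base[of b] by simp
qed

text \<open>The drops of a function along a closed walk add up to zero.\<close>

lemma homogeneous_cycleI:
  assumes "is_cycle A vs es" "cycle_potential vs es f"
  shows "homogeneous_cycle A vs es"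
proof -
  have "real_of_int (\<Sum>k<length vs. cycle_sign vs es k)
      = (\<Sum>k<length vs. f (vs ! k) - f (next_vertex vs k))"
    unfolding of_int_sum using assms(2) by (intro sum.cong) (simp_all add: cycle_potential_def)
  also have "\<dots> = 0" by (simp add: sum_subtractf sum_next_vertex)
  finally have "(\<Sum>k<length vs. cycle_sign vs es k) = 0" by (simp only: of_int_eq_0_iff)
  then show ?thesis using homogeneous_cycle_iff_sum[OF assms(1)] by simp
qed

text \<open>Adding up the signs from position \<open>0\<close> onwards gives a candidate; homogeneity is what makes it
  close up at the last position, and subtracting its minimum makes it nonnegative.  Any other
  candidate differs from it by a constant, which vanishes as both have minimum zero.\<close>

lemma cycle_mu_is_potential:
  assumes "homogeneous_cycle A vs es"
  shows "cycle_potential vs es (\<lambda>v. real (cycle_mu vs es v))"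
proof -
  define l where "l = length vs"
  have cyc: "is_cycle A vs es" using assms by (simp add: homogeneous_cycle_def)
  have l: "l \<ge> 2" "distinct vs"
    and es: "\<And>j. j < l \<Longrightarrow> es ! j = (vs ! j, next_vertex vs j) \<or> es ! j = (next_vertex vs j, vs ! j)"
    using cyc by (auto simp: is_cycle_def l_def)
  have ne: "vs \<noteq> []" using l by (auto simp: l_def)
  define spec where "spec \<mu> \<longleftrightarrow> (\<forall>j < length vs.
        (es ! j = (vs ! j, next_vertex vs j) \<longrightarrow>
           int (\<mu> (next_vertex vs j)) = int (\<mu> (vs ! j)) - 1) \<and>
        (es ! j = (next_vertex vs j, vs ! j) \<longrightarrow>
           int (\<mu> (next_vertex vs j)) = int (\<mu> (vs ! j)) + 1))" for \<mu>
  have spec_iff: "spec \<mu> \<longleftrightarrow> cycle_potential vs es (\<lambda>v. real (\<mu> v))" for \<mu>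
  proof -
    have "((es ! j = (vs ! j, next_vertex vs j) \<longrightarrow>
           int (\<mu> (next_vertex vs j)) = int (\<mu> (vs ! j)) - 1) \<and>
        (es ! j = (next_vertex vs j, vs ! j) \<longrightarrow>
           int (\<mu> (next_vertex vs j)) = int (\<mu> (vs ! j)) + 1)) \<longleftrightarrow>
        real (\<mu> (vs ! j)) - real (\<mu> (next_vertex vs j)) = of_int (cycle_sign vs es j)"
      if "j < length vs" for j
    proof -
      have "next_vertex vs j \<noteq> vs ! j" using next_vertex_neq[OF cyc that] .
      then show ?thesis using es[of j] that unfolding cycle_sign_def l_def by auto
    qed
    then show ?thesis unfolding spec_def cycle_potential_def by blast
  qed
  define h where "h k = - (\<Sum>j<k. cycle_sign vs es j)" for k
  define m where "m = Min (h ` {..<l})"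
  define idx where "idx v = (THE k. k < l \<and> vs ! k = v)" for v
  have idx: "idx (vs ! k) = k" if "k < l" for k
    unfolding idx_def using that l by (intro the_equality) (auto simp: l_def nth_eq_iff_index_eq)
  have m_le: "m \<le> h k" if "k < l" for k unfolding m_def using that by (intro Min_le) auto
  have "m \<in> h ` {..<l}" unfolding m_def using l by (intro Min_in) (auto simp: lessThan_empty_iff)
  then obtain k0 where k0: "k0 < l" "h k0 = m" by auto
  define \<mu>0 where "\<mu>0 v = (if v \<in> set vs then nat (h (idx v) - m) else undefined)" for v
  have \<mu>0: "int (\<mu>0 (vs ! k)) = h k - m" if "k < l" for k
    using that m_le[OF that] idx[OF that] by (simp add: \<mu>0_def l_def)
  have h_l: "h l = 0" using assms homogeneous_cycle_iff_sum[OF cyc] by (simp add: h_def l_def)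
  have step: "int (\<mu>0 (next_vertex vs k)) = h (Suc k) - m" if "k < l" for k
  proof (cases "Suc k = l")
    case True
    then have "next_vertex vs k = vs ! 0" by (simp add: next_vertex_def l_def)
    moreover have "h (Suc k) = h 0" using True h_l by (simp add: h_def)
    ultimately show ?thesis using \<mu>0[of 0] l by simp
  next
    case False
    then show ?thesis using that \<mu>0[of "Suc k"] by (simp add: next_vertex_Suc l_def)
  qed
  have "cycle_potential vs es (\<lambda>v. real (\<mu>0 v))"
    unfolding cycle_potential_def
  proof (intro allI impI)
    fix k assume "k < length vs"
    then have k: "k < l" by (simp add: l_def)
    have "int (\<mu>0 (vs ! k)) - int (\<mu>0 (next_vertex vs k)) = cycle_sign vs es k"
      using \<mu>0[OF k] step[OF k] by (simp add: h_def)
    then show "real (\<mu>0 (vs ! k)) - real (\<mu>0 (next_vertex vs k)) = of_int (cycle_sign vs es k)"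
      by linarith
  qed
  then have 1: "spec \<mu>0" by (simp add: spec_iff)
  have "\<mu>0 (vs ! k0) = 0" using \<mu>0[OF k0(1)] k0(2) by simp
  then have "0 \<in> \<mu>0 ` set vs" using k0 by (metis image_eqI l_def nth_mem)
  then have 2: "Min (\<mu>0 ` set vs) = 0" by (intro Min_eqI) auto
  have 3: "\<mu>0 \<in> extensional (set vs)" by (simp add: \<mu>0_def extensional_def)
  have uniq: "\<nu> = \<mu>0" if n: "\<nu> \<in> extensional (set vs)" "spec \<nu>" "Min (\<nu> ` set vs) = 0" for \<nu>
  proof (rule extensionalityI[OF n(1) 3])
    fix v assume v: "v \<in> set vs"
    have "0 \<in> \<nu> ` set vs" "0 \<in> \<mu>0 ` set vs"
      using Min_in[of "\<nu> ` set vs"] Min_in[of "\<mu>0 ` set vs"] n(3) 2 ne by simp_all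
    then obtain a b where ab: "a \<in> set vs" "\<nu> a = 0" "b \<in> set vs" "\<mu>0 b = 0" by auto
    have d: "real (\<nu> v) - real (\<nu> w) = real (\<mu>0 v) - real (\<mu>0 w)" if "w \<in> set vs" for w
      using cycle_potential_diff_unique[of vs es "\<lambda>v. real (\<nu> v)" "\<lambda>v. real (\<mu>0 v)"] n(2) 1 v that
      by (simp add: spec_iff)
    show "\<nu> v = \<mu>0 v" using d[OF ab(1)] d[OF ab(3)] ab by simp
  qed
  have "cycle_mu vs es = \<mu>0"
    unfolding cycle_mu_def spec_def[symmetric] using 1 2 3 uniq by (intro the_equality) blast+
  then show ?thesis using 1 by (simp add: spec_iff)
qed

section \<open>Directed distance and functions that drop by at most one along arrows\<close>

text \<open>If the new first vertex already lies on the path, the part of the path from there on will do.\<close>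

lemma directed_path_Cons:
  assumes "(i, j) \<in> A" "directed_path A j p k"
  shows "\<exists>q. directed_path A i q k \<and> length q \<le> Suc (length p)"
proof (cases "i \<in> set p")
  case False
  have "directed_path A i (i # p) k"
    using assms False by (cases p) (auto simp: directed_path_def)
  then show ?thesis by (intro exI[of _ "i # p"]) simp
next
  case True
  then obtain xs ys where p: "p = xs @ i # ys" by (meson split_list)
  have "directed_path A i (i # ys) k"
    using assms(2) p by (auto simp: directed_path_def successively_append_iff)
  then show ?thesis using p by (intro exI[of _ "i # ys"]) simp
qed

lemma directed_path_if_rtrancl:
  assumes "(i, j) \<in> A\<^sup>*"
  shows "\<exists>p. directed_path A i p j"
  using assms
proof (induction rule: converse_rtrancl_induct)
  case base
  show ?case by (intro exI[of _ "[j]"]) (simp add: directed_path_def)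
next
  case (step i k)
  then show ?case using directed_path_Cons by metis
qed

lemma digraph_dist_attained:
  assumes "digraph_dist A i j \<noteq> \<infinity>"
  obtains p where "directed_path A i p j" "digraph_dist A i j = enat (length p - 1)"
proof -
  let ?S = "{enat (length p - 1) | p. directed_path A i p j}"
  have "?S \<noteq> {}" using assms unfolding digraph_dist_def Inf_enat_def by metis
  then have "Inf ?S \<in> ?S" unfolding Inf_enat_def by (auto intro: LeastI2)
  then show ?thesis using that unfolding digraph_dist_def by blast
qed

lemma digraph_dist_le: "directed_path A i p j \<Longrightarrow> digraph_dist A i j \<le> enat (length p - 1)"
  unfolding digraph_dist_def by (rule Inf_lower) blast

lemma digraph_dist_finite:
  assumes "(i, j) \<in> A\<^sup>*"
  shows "digraph_dist A i j \<noteq> \<infinity>"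
  using directed_path_if_rtrancl[OF assms] digraph_dist_le[of A i _ j]
  by (metis enat_ord_simps(5) infinity_ileE)

lemma digraph_dist_self [simp]: "digraph_dist A i i = 0"
proof -
  have "directed_path A i [i] i" by (simp add: directed_path_def)
  from digraph_dist_le[OF this] show ?thesis by (simp add: zero_enat_def[symmetric])
qed

lemma digraph_dist_step:
  assumes "(i, j) \<in> A"
  shows "digraph_dist A i k \<le> digraph_dist A j k + 1"
proof (cases "digraph_dist A j k = \<infinity>")
  case False
  then obtain p where p: "directed_path A j p k" "digraph_dist A j k = enat (length p - 1)"
    by (rule digraph_dist_attained)
  obtain q where q: "directed_path A i q k" "length q \<le> Suc (length p)"
    using directed_path_Cons[OF assms p(1)] by blast
  have "p \<noteq> []" "q \<noteq> []" using p(1) q(1) by (auto simp: directed_path_def)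
  then have "length q - 1 \<le> (length p - 1) + 1" using q(2) by (cases p) auto
  then have "enat (length q - 1) \<le> enat (length p - 1) + 1"
    by (simp add: one_enat_def)
  then show ?thesis using digraph_dist_le[OF q(1)] p(2) by simp
qed simp

text \<open>In terms of functionals on the space: those that are at most \<open>1\<close> on the polytope.\<close>

definition subpotential :: "('n \<times> 'n) set \<Rightarrow> ('n \<Rightarrow> real) \<Rightarrow> bool" where
  "subpotential A f \<longleftrightarrow> (\<forall>(i, j)\<in>A. f i - f j \<le> 1)"

lemma subpotential_path_bound:
  assumes "subpotential A f" "directed_path A i p j"
  shows "f i - f j \<le> real (length p - 1)"
  using assms(2)
proof (induction p arbitrary: i)
  case (Cons x p)
  show ?case
  proof (cases "p = []")
    case True
    then show ?thesis using Cons.prems by (auto simp: directed_path_def)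
  next
    case False
    have "directed_path A (hd p) p j" "(i, hd p) \<in> A"
      using Cons.prems False by (cases p; auto simp: directed_path_def)+
    moreover from this have "f i - f (hd p) \<le> 1" using assms(1) by (auto simp: subpotential_def)
    ultimately show ?thesis using Cons.IH[of "hd p"] False by (cases p) auto
  qed
qed (simp add: directed_path_def)

lemma subpotential_le_dist:
  assumes "subpotential A f"
  shows "ereal (f i - f j) \<le> ereal_of_enat (digraph_dist A i j)"
proof (cases "digraph_dist A i j = \<infinity>")
  case False
  then obtain p where p: "directed_path A i p j" "digraph_dist A i j = enat (length p - 1)"
    by (rule digraph_dist_attained)
  then show ?thesis using subpotential_path_bound[OF assms p(1)] by simp
qed simp

text \<open>The McShane extension \<open>f v = min (g c + dist v c)\<close> over \<open>c \<in> S\<close>.  The triangle inequality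
  bounds its drop along an arrow, and the hypothesis on \<open>g\<close> says that for \<open>v \<in> S\<close> no \<open>c\<close> gives
  less than \<open>c = v\<close> does.\<close>

lemma subpotential_extension:
  fixes g :: "'n \<Rightarrow> real"
  assumes "A\<^sup>* = UNIV" "finite S" "S \<noteq> {}"
    and g: "\<And>u v. u \<in> S \<Longrightarrow> v \<in> S \<Longrightarrow> ereal (g u - g v) \<le> ereal_of_enat (digraph_dist A u v)"
  shows "\<exists>f. subpotential A f \<and> (\<forall>v\<in>S. f v = g v)"
proof -
  define d where "d u v = real (the_enat (digraph_dist A u v))" for u v
  have d: "ereal_of_enat (digraph_dist A u v) = ereal (d u v)" for u v
    using digraph_dist_finite[of u v A] assms(1) by (cases "digraph_dist A u v") (auto simp: d_def)
  have d_step: "d i c \<le> d j c + 1" if "(i, j) \<in> A" for i j c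
  proof -
    have "ereal_of_enat (digraph_dist A i c) \<le> ereal_of_enat (digraph_dist A j c + 1)"
      using digraph_dist_step[OF that] by (simp only: ereal_of_enat_le_iff)
    then show ?thesis by (simp add: ereal_of_enat_add d one_enat_def)
  qed
  define f where "f v = Min ((\<lambda>c. g c + d v c) ` S)" for v
  have f_le: "f v \<le> g c + d v c" if "c \<in> S" for v c
    unfolding f_def using that assms(2) by (intro Min_le) auto
  have f_attained: "\<exists>c\<in>S. f v = g c + d v c" for v
  proof -
    have "f v \<in> (\<lambda>c. g c + d v c) ` S"
      unfolding f_def using assms(2,3) by (intro Min_in) auto
    then show ?thesis by auto
  qed
  have "subpotential A f"
    unfolding subpotential_def
  proof clarify
    fix i j assume ij: "(i, j) \<in> A"
    obtain c where "c \<in> S" "f j = g c + d j c" using f_attained by blast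
    then show "f i - f j \<le> 1" using f_le[of c i] d_step[OF ij, of c] by simp
  qed
  moreover have "f v = g v" if v: "v \<in> S" for v
  proof (rule antisym)
    have "d v v = 0" by (simp add: d_def zero_enat_def)
    then show "f v \<le> g v" using f_le[OF v, of v] by simp
    obtain c where "c \<in> S" "f v = g c + d v c" using f_attained by blast
    then show "g v \<le> f v" using g[OF v, of c] by (simp add: d)
  qed
  ultimately show ?thesis by blast
qed

section \<open>Strong connectivity\<close>

lemma rtrancl_along_closed_walk:
  assumes "\<And>k. k < length vs \<Longrightarrow> (vs ! k, next_vertex vs k) \<in> R" "a < length vs" "b < length vs"
  shows "(vs ! a, vs ! b) \<in> R\<^sup>*"
proof -
  have *: "(vs ! a, vs ! ((a + n) mod length vs)) \<in> R\<^sup>*" for n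
  proof (induction n)
    case (Suc n)
    have "(a + n) mod length vs < length vs" using assms(2) by (intro mod_less_divisor) linarith
    from assms(1)[OF this] show ?case using Suc
      by (auto simp: next_vertex_def mod_Suc_eq intro: rtrancl_into_rtrancl)
  qed (use assms(2) in simp)
  have "(a + (b + length vs - a)) mod length vs = b" using assms by simp
  then show ?thesis using *[of "b + length vs - a"] by simp
qed

text \<open>An arrow counts as forward if some position traverses it forwards; as the arrows are distinct,
  this is the only position where it occurs, so the orientation can be read off position by position.\<close>

lemma directed_cycle_orientation:
  assumes "directed_cycle A vs es"
  shows "(\<forall>k<length vs. (vs ! k, next_vertex vs k) \<in> A) \<or>
         (\<forall>k<length vs. (next_vertex vs k, vs ! k) \<in> A)"
proof -
  have cyc: "is_cycle A vs es" using assms by (simp add: directed_cycle_def)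
  have len: "length es = length vs" and sub: "set es \<subseteq> A"
    and es: "\<And>k. k < length vs \<Longrightarrow> es ! k = (vs ! k, next_vertex vs k) \<or> es ! k = (next_vertex vs k, vs ! k)"
    using cyc by (auto simp: is_cycle_def)
  have inA: "es ! k \<in> A" if "k < length vs" for k using that sub len by auto
  show ?thesis
  proof (cases "Delta_plus vs es = {}")
    case True
    then have "es ! k \<noteq> (vs ! k, next_vertex vs k)" if "k < length vs" for k
      using that unfolding Delta_plus_def by blast
    then show ?thesis using es inA by metis
  next
    case False
    then have sub': "set es \<subseteq> Delta_plus vs es"
      using assms by (auto simp: directed_cycle_def Delta_minus_def)
    have "es ! k = (vs ! k, next_vertex vs k)" if k: "k < length vs" for k
    proof -
      have "es ! k \<in> Delta_plus vs es" using sub' k len by auto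
      then obtain j where j: "j < length vs" "es ! k = es ! j" "es ! j = (vs ! j, next_vertex vs j)"
        by (auto simp: Delta_plus_def)
      then have "j = k"
        using cycle_arrows_distinct[OF cyc] k len nth_eq_iff_index_eq[of es j k] by simp
      then show ?thesis using j by simp
    qed
    then show ?thesis using inA by metis
  qed
qed

text \<open>An arrow can be undone by walking along the rest of a directed cycle through it, so the
  undirected connections are also directed ones.\<close>

lemma strongly_connected:
  assumes conn: "underlying_connected A"
    and cyc: "\<forall>a\<in>A. \<exists>vs es. directed_cycle A vs es \<and> a \<in> set es"
  shows "A\<^sup>* = UNIV"
proof -
  have rev: "(j, i) \<in> A\<^sup>*" if ij: "(i, j) \<in> A" for i j
  proof -
    obtain vs es where c: "directed_cycle A vs es" "(i, j) \<in> set es" using cyc ij by blast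
    then have ic: "is_cycle A vs es" by (simp add: directed_cycle_def)
    then obtain k where "k < length vs" "(i, j) = (vs ! k, next_vertex vs k) \<or> (i, j) = (next_vertex vs k, vs ! k)"
      using c(2) by (auto simp: is_cycle_def in_set_conv_nth)
    then have "i \<in> set vs" "j \<in> set vs" using next_vertex_in_set by auto
    then obtain a b where ab: "a < length vs" "vs ! a = j" "b < length vs" "vs ! b = i"
      by (metis in_set_conv_nth)
    from directed_cycle_orientation[OF c(1)] show ?thesis
    proof
      assume "\<forall>k<length vs. (vs ! k, next_vertex vs k) \<in> A"
      then show ?thesis using rtrancl_along_closed_walk[of vs A a b] ab by auto
    next
      assume "\<forall>k<length vs. (next_vertex vs k, vs ! k) \<in> A"
      then have "(i, j) \<in> (A\<inverse>)\<^sup>*" using rtrancl_along_closed_walk[of vs "A\<inverse>" b a] ab by auto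
      then show ?thesis by (simp add: rtrancl_converse)
    qed
  qed
  have "{(u, v). {u, v} \<in> undirected_edges A} \<subseteq> A\<^sup>*"
    using rev by (auto simp: undirected_edges_def doubleton_eq_iff)
  then have "{(u, v). {u, v} \<in> undirected_edges A}\<^sup>* \<subseteq> A\<^sup>*"
    by (metis rtrancl_idemp rtrancl_mono)
  then show ?thesis using conn by (auto simp: underlying_connected_def)
qed

lemma constant_if_monotone_along_arrows:
  fixes f :: "'n \<Rightarrow> 'b::order"
  assumes "A\<^sup>* = UNIV" "\<And>i j. (i, j) \<in> A \<Longrightarrow> f i \<le> f j"
  shows "f u = f v"
proof -
  have "f x \<le> f y" if "(x, y) \<in> A\<^sup>*" for x y
    using that by induction (use assms(2) order_trans in blast)+
  then show ?thesis using assms(1) by (auto intro: antisym)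
qed

section \<open>Faces cut out by functionals\<close>

definition tight_arrows :: "('n::finite \<times> 'n) set \<Rightarrow> real ^ 'n \<Rightarrow> ('n \<times> 'n) set" where
  "tight_arrows A a = {e \<in> A. a \<bullet> arrow_vec e = 1}"

definition level_face :: "('n::finite \<times> 'n) set \<Rightarrow> real ^ 'n \<Rightarrow> (real ^ 'n) set" where
  "level_face A a = digraph_polytope A \<inter> {x. a \<bullet> x = 1}"

lemma arrow_vec_in_polytope: "e \<in> A \<Longrightarrow> arrow_vec e \<in> digraph_polytope A"
  by (simp add: digraph_polytope_eq hull_inc)

lemma polytope_digraph_polytope: "polytope (digraph_polytope A)"
  by (simp add: digraph_polytope_eq polytope_convex_hull)

lemma convex_digraph_polytope: "convex (digraph_polytope A)"
  by (simp add: digraph_polytope_eq)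

lemma inner_le_on_polytope:
  assumes "\<And>e. e \<in> A \<Longrightarrow> a \<bullet> arrow_vec e \<le> b" "x \<in> digraph_polytope A"
  shows "a \<bullet> x \<le> b"
proof -
  have "digraph_polytope A \<subseteq> {x. a \<bullet> x \<le> b}"
    unfolding digraph_polytope_eq
    using assms(1) by (intro hull_minimal) (auto simp: convex_halfspace_le simp del: inner_arrow_vec)
  then show ?thesis using assms(2) by blast
qed

lemma level_face_is_face:
  assumes "subpotential A (($) a)"
  shows "level_face A a face_of digraph_polytope A"
  unfolding level_face_def
proof (rule face_of_Int_supporting_hyperplane_le[OF convex_digraph_polytope])
  show "a \<bullet> x \<le> 1" if "x \<in> digraph_polytope A" for x
  proof (rule inner_le_on_polytope[OF _ that])
    show "a \<bullet> arrow_vec e \<le> 1" if "e \<in> A" for e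
      using assms that by (auto simp: subpotential_def)
  qed
qed

text \<open>Otherwise the functional would drop by one along every arrow, which is impossible because
  every arrow can be undone by a directed walk.\<close>

lemma level_face_proper:
  assumes "A\<^sup>* = UNIV" "A \<noteq> {}"
  shows "level_face A a \<noteq> digraph_polytope A"
proof
  assume eq: "level_face A a = digraph_polytope A"
  then have one: "a \<bullet> arrow_vec e = 1" if "e \<in> A" for e
    using arrow_vec_in_polytope[OF that] eq unfolding level_face_def by blast
  obtain i j where ij: "(i, j) \<in> A" using assms(2) by auto
  have "a $ j = a $ i"
  proof (rule constant_if_monotone_along_arrows[of "A\<inverse>"])
    show "(A\<inverse>)\<^sup>* = UNIV" using assms(1) by (simp add: rtrancl_converse)
    show "a $ i \<le> a $ j" if "(i, j) \<in> A\<inverse>" for i j using one[of "(j, i)"] that by simp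
  qed
  then show False using one[OF ij] by simp
qed

text \<open>Faces of a polytope are exposed, so \<open>F\<close> is given by an equation \<open>a \<bullet> x = b\<close>; rescaling
  gives \<open>b = 1\<close> once \<open>b > 0\<close>.  If \<open>b\<close> were not positive, \<open>a\<close> could not decrease along any
  arrow, so by strong connectivity it would be constant and vanish on the whole polytope,
  and \<open>F\<close> would be all of it.\<close>

lemma facet_is_level_face:
  assumes "A\<^sup>* = UNIV" "F facet_of digraph_polytope A"
  shows "\<exists>a. subpotential A (($) a) \<and> F = level_face A a"
proof -
  let ?P = "digraph_polytope A"
  have F: "F face_of ?P" "F \<noteq> {}" "aff_dim F = aff_dim ?P - 1"
    using assms(2) by (auto simp: facet_of_def)
  have "F exposed_face_of ?P"
    using F(1) exposed_face_of_polyhedron polytope_imp_polyhedron[OF polytope_digraph_polytope] by blast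
  then obtain a b where ab: "?P \<subseteq> {x. a \<bullet> x \<le> b}" "F = ?P \<inter> {x. a \<bullet> x = b}"
    by (auto simp: exposed_face_of_def)
  have le: "a $ i - a $ j \<le> b" if "(i, j) \<in> A" for i j
    using arrow_vec_in_polytope[OF that] ab(1) by auto
  have "b > 0"
  proof (rule ccontr)
    assume "\<not> b > 0"
    then have mono: "a $ i \<le> a $ j" if "(i, j) \<in> A" for i j
      using le[OF that] by simp
    have const: "a $ u = a $ v" for u v
      by (rule constant_if_monotone_along_arrows[OF assms(1) mono])
    have "?P \<noteq> {}" using F face_of_imp_subset by blast
    then obtain e where e: "e \<in> A" by (auto simp: digraph_polytope_eq)
    have "b \<ge> 0" using le[of "fst e" "snd e"] e const[of "fst e" "snd e"] by simp
    then have b: "b = 0" using \<open>\<not> b > 0\<close> by simp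
    have "a \<bullet> x = 0" if "x \<in> ?P" for x
    proof -
      have "a \<bullet> arrow_vec e \<le> 0" "(- a) \<bullet> arrow_vec e \<le> 0" for e
        using const[of "fst e" "snd e"] by auto
      then have "a \<bullet> x \<le> 0" "(- a) \<bullet> x \<le> 0"
        using that inner_le_on_polytope by blast+
      then show ?thesis by simp
    qed
    then have "F = ?P" using ab(2) b by auto
    then show False using F(3) by simp
  qed
  let ?c = "(1 / b) *\<^sub>R a"
  have "F = level_face A ?c"
    using \<open>b > 0\<close> by (auto simp: level_face_def ab(2))
  moreover have "subpotential A (($) ?c)"
    using le \<open>b > 0\<close> by (auto simp: subpotential_def field_simps)
  ultimately show ?thesis by blast
qed

text \<open>The vector itself, used as a functional, has the value \<open>2\<close> there and at most \<open>1\<close> at all the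
  other arrow vectors.\<close>

lemma arrow_vec_extreme_point:
  assumes "irrefl A" "e \<in> A"
  shows "arrow_vec e extreme_point_of digraph_polytope A"
proof -
  obtain i j where e: "e = (i, j)" by (cases e)
  have ij: "i \<noteq> j" using assms e by (auto simp: irrefl_def)
  let ?c = "arrow_vec e" and ?S = "arrow_vec ` (A - {e})"
  have c: "?c $ k = (if k = i then 1 else 0) - (if k = j then 1 else 0)" for k
    by (simp add: e arrow_vec_Pair axis_def)
  have le: "?c \<bullet> arrow_vec e' \<le> 1" if "e' \<in> A - {e}" for e'
  proof -
    obtain k l where e': "e' = (k, l)" by (cases e')
    have "k \<noteq> l" "(k, l) \<noteq> (i, j)" using that assms(1) e e' by (auto simp: irrefl_def)
    then show ?thesis using ij unfolding inner_arrow_vec c by (auto simp: e')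
  qed
  have "convex hull ?S \<subseteq> {x. ?c \<bullet> x \<le> 1}"
    using le by (intro hull_minimal) (auto simp: convex_halfspace_le simp del: inner_arrow_vec)
  moreover have "?c \<bullet> ?c = 2"
    unfolding inner_arrow_vec c using ij by (auto simp: e)
  ultimately have "arrow_vec e \<notin> convex hull ?S" by auto
  then have "arrow_vec e extreme_point_of convex hull (insert (arrow_vec e) ?S)"
    by (intro extreme_point_of_convex_hull_insert) auto
  moreover have "insert (arrow_vec e) ?S = arrow_vec ` A" using assms(2) by auto
  ultimately show ?thesis by (simp add: digraph_polytope_eq)
qed

lemma extreme_points_level_face:
  assumes "irrefl A" "subpotential A (($) a)"
  shows "{v. v extreme_point_of level_face A a} = arrow_vec ` tight_arrows A a"
proof -
  have "v extreme_point_of level_face A a \<longleftrightarrow> v extreme_point_of digraph_polytope A \<and> a \<bullet> v = 1" for v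
    using extreme_point_of_face[OF level_face_is_face[OF assms(2)], of v]
    by (auto simp: level_face_def extreme_point_of_def)
  moreover have "v extreme_point_of digraph_polytope A \<longleftrightarrow> v \<in> arrow_vec ` A" for v
    using arrow_vec_extreme_point[OF assms(1)] extreme_point_of_convex_hull
    by (auto simp: digraph_polytope_eq)
  ultimately show ?thesis by (auto simp: tight_arrows_def)
qed

lemma level_face_eq_convex_hull:
  assumes "irrefl A" "subpotential A (($) a)"
  shows "level_face A a = convex hull (arrow_vec ` tight_arrows A a)"
proof -
  have "polytope (level_face A a)"
    using face_of_polytope_polytope[OF polytope_digraph_polytope level_face_is_face[OF assms(2)]] .
  then have "level_face A a = convex hull {v. v extreme_point_of level_face A a}"
    by (intro Krein_Milman_Minkowski polytope_imp_compact polytope_imp_convex)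
  then show ?thesis by (simp add: extreme_points_level_face[OF assms])
qed

text \<open>If the tight arrows left the vertices in several components, the functional could be raised
  on one component \<open>S\<close> until an arrow leaving \<open>S\<close> becomes tight, without losing any tight arrow.
  That yields a proper face strictly larger than the facet.\<close>

lemma facet_tight_connected:
  fixes A :: "('n::finite \<times> 'n) set" and a :: "real ^ 'n"
  assumes strong: "A\<^sup>* = UNIV" and irr: "irrefl A" and sub: "subpotential A (($) a)"
    and facet: "level_face A a facet_of digraph_polytope A"
  shows "(tight_arrows A a \<union> (tight_arrows A a)\<inverse>)\<^sup>* = UNIV"
proof (rule ccontr)
  let ?T = "tight_arrows A a"
  let ?R = "(?T \<union> ?T\<inverse>)\<^sup>*"
  assume "?R \<noteq> UNIV"
  then obtain r s where rs: "(r, s) \<notin> ?R" by auto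
  define S where "S = {v. (r, v) \<in> ?R}"
  define ind where "ind = (\<chi> v. if v \<in> S then 1 else (0::real))"
  have ind: "ind $ v = (if v \<in> S then 1 else 0)" for v by (simp add: ind_def)
  have closed: "u \<in> S \<longleftrightarrow> v \<in> S" if "(u, v) \<in> ?T" for u v
    using that unfolding S_def by (auto intro: rtrancl_into_rtrancl)
  define L where "L = {e \<in> A. fst e \<in> S \<and> snd e \<notin> S}"
  have "L \<noteq> {}"
  proof
    assume "L = {}"
    have "s \<in> S" if "(r, s) \<in> A\<^sup>*" for s using that
    proof induction
      case (step u v)
      then show ?case using \<open>L = {}\<close> by (auto simp: L_def)
    qed (simp add: S_def)
    then show False using rs strong by (auto simp: S_def)
  qed
  \<comment> \<open>The largest amount by which the functional may be raised on \<open>S\<close>: the least slack of an arrow leaving \<open>S\<close>.\<close>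
  define t where "t = Min ((\<lambda>e. 1 - a \<bullet> arrow_vec e) ` L)"
  have "t \<in> (\<lambda>e. 1 - a \<bullet> arrow_vec e) ` L"
    unfolding t_def using \<open>L \<noteq> {}\<close> by (intro Min_in) auto
  then obtain e0 where e0: "e0 \<in> L" "t = 1 - a \<bullet> arrow_vec e0" by auto
  have t_le: "t \<le> 1 - a \<bullet> arrow_vec e" if "e \<in> L" for e
    unfolding t_def using that by (intro Min_le) auto
  have le: "a \<bullet> arrow_vec e \<le> 1" if "e \<in> A" for e
    using sub that by (auto simp: subpotential_def)
  have "e0 \<notin> ?T" using closed[of "fst e0" "snd e0"] e0(1) by (auto simp: L_def)
  then have "t > 0" using le[of e0] e0 by (auto simp: tight_arrows_def L_def less_le)
  let ?a = "a + t *\<^sub>R ind"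
  have inner: "?a \<bullet> arrow_vec e = a \<bullet> arrow_vec e + t * (ind $ fst e - ind $ snd e)" for e
    by (simp add: algebra_simps)
  have sub': "subpotential A (($) ?a)"
    unfolding subpotential_def
  proof clarify
    fix i j assume ij: "(i, j) \<in> A"
    have "?a \<bullet> arrow_vec (i, j) \<le> 1"
    proof (cases "(i, j) \<in> L")
      case True
      then show ?thesis using t_le[OF True] by (simp add: inner ind L_def)
    next
      case False
      then have "ind $ i - ind $ j \<le> 0" using ij by (auto simp: ind L_def)
      then have "t * (ind $ i - ind $ j) \<le> 0" using \<open>t > 0\<close> by (simp add: mult_nonneg_nonpos)
      then show ?thesis using le[OF ij] unfolding inner by simp
    qed
    then show "?a $ i - ?a $ j \<le> 1" by simp
  qed
  have subset: "?T \<subseteq> tight_arrows A ?a"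
    using closed by (auto simp: tight_arrows_def ind)
  have e0_tight: "e0 \<in> tight_arrows A ?a"
    using e0 by (simp add: tight_arrows_def inner ind L_def)
  have "A \<noteq> {}" using e0(1) by (auto simp: L_def)
  have face: "level_face A a face_of level_face A ?a"
  proof (rule face_of_subset)
    show "level_face A a face_of digraph_polytope A" by (rule level_face_is_face[OF sub])
    show "level_face A a \<subseteq> level_face A ?a"
      unfolding level_face_eq_convex_hull[OF irr sub] level_face_eq_convex_hull[OF irr sub']
      using subset by (intro hull_mono image_mono)
    show "level_face A ?a \<subseteq> digraph_polytope A" by (auto simp: level_face_def)
  qed
  have "arrow_vec e0 \<in> level_face A ?a" "arrow_vec e0 \<notin> level_face A a"
    using e0_tight \<open>e0 \<notin> ?T\<close> arrow_vec_in_polytope[of e0 A]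
    by (auto simp: level_face_def tight_arrows_def simp del: inner_arrow_vec)
  then have "level_face A a \<noteq> level_face A ?a" by blast
  moreover have "convex (level_face A ?a)"
    using level_face_is_face[OF sub'] face_of_imp_convex by blast
  ultimately have "aff_dim (level_face A a) < aff_dim (level_face A ?a)"
    using face_of_aff_dim_lt face by blast
  moreover have "aff_dim (level_face A ?a) < aff_dim (digraph_polytope A)"
    using face_of_aff_dim_lt[OF convex_digraph_polytope level_face_is_face[OF sub']]
      level_face_proper[OF strong \<open>A \<noteq> {}\<close>] by blast
  ultimately show False using facet by (simp add: facet_of_def)
qed

section \<open>Linear relations among arrow vectors\<close>

lemma int_independent_if_independent:
  fixes B :: "'a::real_vector set"
  assumes "independent B"
  shows "\<not> int_module.dependent B"
proof
  assume "int_module.dependent B"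
  then obtain t and u :: "'a \<Rightarrow> int" where "finite t" "t \<subseteq> B"
    "(\<Sum>v\<in>t. real_of_int (u v) *\<^sub>R v) = 0" "\<exists>v\<in>t. u v \<noteq> 0"
    by (auto simp: int_module.dependent_explicit)
  then show False
    using assms independentD[of B t "\<lambda>v. real_of_int (u v)"] by auto
qed

lemma independent_if_separated:
  fixes B :: "'a::real_inner set"
  assumes "\<And>v. v \<in> B \<Longrightarrow> \<exists>c. c \<bullet> v \<noteq> 0 \<and> (\<forall>w\<in>B - {v}. c \<bullet> w = 0)"
  shows "independent B"
  unfolding dependent_def
proof clarify
  fix v assume v: "v \<in> B" "v \<in> span (B - {v})"
  then obtain c where c: "c \<bullet> v \<noteq> 0" "\<forall>w\<in>B - {v}. c \<bullet> w = 0" using assms by blast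
  have "span (B - {v}) \<subseteq> {x. c \<bullet> x = 0}"
    using c(2) by (intro span_minimal subspace_hyperplane) auto
  then show False using v(2) c(1) by auto
qed

text \<open>When \<open>e\<close> is a bridge, the indicator function of one of the two sides is a functional that vanishes
  on all the other arrow vectors but not on that of \<open>e\<close>.\<close>

lemma independent_if_all_bridges:
  fixes T :: "('n::finite \<times> 'n) set"
  assumes bridge: "\<And>e. e \<in> T \<Longrightarrow> e \<notin> ((T - {e}) \<union> (T - {e})\<inverse>)\<^sup>*"
  shows "independent (arrow_vec ` T)"
proof (rule independent_if_separated)
  fix v :: "real ^ 'n" assume "v \<in> arrow_vec ` T"
  then obtain e where e: "e \<in> T" "v = arrow_vec e" by auto
  let ?R = "((T - {e}) \<union> (T - {e})\<inverse>)\<^sup>*"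
  define c where "c = (\<chi> k. if (fst e, k) \<in> ?R then 1 else (0::real))"
  have "c \<bullet> v \<noteq> 0" using bridge[OF e(1)] by (simp add: e(2) c_def)
  moreover have "c \<bullet> w = 0" if w: "w \<in> arrow_vec ` T - {v}" for w
  proof -
    obtain e' where e': "e' \<in> T - {e}" "w = arrow_vec e'" using w e(2) by auto
    have "(fst e, fst e') \<in> ?R \<longleftrightarrow> (fst e, snd e') \<in> ?R"
    proof
      have "(fst e', snd e') \<in> (T - {e}) \<union> (T - {e})\<inverse>" using e'(1) by auto
      then show "(fst e, fst e') \<in> ?R \<Longrightarrow> (fst e, snd e') \<in> ?R" by (rule rtrancl_into_rtrancl[rotated])
      have "(snd e', fst e') \<in> (T - {e}) \<union> (T - {e})\<inverse>" using e'(1) by auto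
      then show "(fst e, snd e') \<in> ?R \<Longrightarrow> (fst e, fst e') \<in> ?R" by (rule rtrancl_into_rtrancl[rotated])
    qed
    then show ?thesis by (simp add: e'(2) c_def)
  qed
  ultimately show "\<exists>c. c \<bullet> v \<noteq> 0 \<and> (\<forall>w\<in>arrow_vec ` T - {v}. c \<bullet> w = 0)" by blast
qed

text \<open>An arrow together with a path that avoids it and joins its endpoints is a cycle.  Asymmetry of
  \<open>T\<close> excludes a path of length one, so the cycle has at least three vertices.\<close>

lemma cycle_if_not_bridge:
  assumes asym: "\<And>i j. (i, j) \<in> T \<Longrightarrow> (j, i) \<notin> T"
    and e: "(i, j) \<in> T" "(i, j) \<in> ((T - {(i, j)}) \<union> (T - {(i, j)})\<inverse>)\<^sup>*"
  shows "\<exists>vs es. is_cycle T vs es"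
proof -
  let ?R = "(T - {(i, j)}) \<union> (T - {(i, j)})\<inverse>"
  obtain vs where vs: "directed_path ?R i vs j" using directed_path_if_rtrancl[OF e(2)] by blast
  define l where "l = length vs"
  \<comment> \<open>By asymmetry this picks the arrow \<open>(i, j)\<close>, traversed backwards, at the last position.\<close>
  define es where "es = map (\<lambda>k. if (vs ! k, next_vertex vs k) \<in> T
      then (vs ! k, next_vertex vs k) else (next_vertex vs k, vs ! k)) [0..<l]"
  have ne: "vs \<noteq> []" and dist: "distinct vs" and hd: "vs ! 0 = i" and last: "vs ! (l - 1) = j"
    using vs by (auto simp: directed_path_def hd_conv_nth last_conv_nth l_def)
  have step: "(vs ! k, vs ! Suc k) \<in> ?R" if "Suc k < l" for k
    using vs that by (auto simp: directed_path_def successively_conv_nth l_def)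
  have "i \<noteq> j" using asym e(1) by blast
  have l3: "l \<ge> 3"
  proof (rule ccontr)
    assume "\<not> l \<ge> 3"
    then have "l = 1 \<or> l = 2" using ne by (cases l) (auto simp: l_def)
    then show False
    proof
      assume "l = 1"
      then show False using hd last \<open>i \<noteq> j\<close> by simp
    next
      assume "l = 2"
      then have "(i, j) \<in> ?R" using step[of 0] hd last by (simp add: numeral_2_eq_2)
      then show False using asym e(1) by blast
    qed
  qed
  have arrow: "(vs ! k, next_vertex vs k) \<in> T \<or> (next_vertex vs k, vs ! k) \<in> T" if k: "k < l" for k
  proof (cases "Suc k < l")
    case True
    then show ?thesis using step[OF True] by (auto simp: next_vertex_def l_def)
  next
    case False
    then have "k = l - 1" "Suc k = l" using k by simp_all
    then show ?thesis using hd last e(1) by (simp add: next_vertex_def l_def)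
  qed
  have "is_cycle T vs es"
    unfolding is_cycle_def l_def[symmetric]
  proof (intro conjI)
    show "set es \<subseteq> T" by (auto simp: es_def dest: arrow)
  qed (use dist l3 in \<open>auto simp: es_def\<close>)
  then show ?thesis by blast
qed

lemma is_cycle_mono: "is_cycle T vs es \<Longrightarrow> T \<subseteq> A \<Longrightarrow> is_cycle A vs es"
  by (auto simp: is_cycle_def)

text \<open>Every arrow of the cycle is tight, and traversing a tight arrow forwards or backwards changes the
  functional by one, in the direction recorded by the sign.\<close>

lemma tight_cycle_potential:
  assumes "is_cycle (tight_arrows A a) vs es"
  shows "cycle_potential vs es (($) a)"
  unfolding cycle_potential_def
proof (intro allI impI)
  fix k assume k: "k < length vs"
  have "es ! k \<in> tight_arrows A a" using assms k by (auto simp: is_cycle_def)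
  then have *: "a $ fst (es ! k) - a $ snd (es ! k) = 1" by (simp add: tight_arrows_def)
  have "es ! k = (vs ! k, next_vertex vs k) \<or> es ! k = (next_vertex vs k, vs ! k)"
    using assms k by (auto simp: is_cycle_def)
  then show "a $ (vs ! k) - a $ next_vertex vs k = of_int (cycle_sign vs es k)"
    using next_vertex_neq[OF assms k] * by (auto simp: cycle_sign_def)
qed

text \<open>Multiplying by the sign orients all the arrows along the cycle, so the sum telescopes.\<close>

lemma cycle_arrow_vec_relation:
  fixes A :: "('n::finite \<times> 'n) set"
  assumes "is_cycle A vs es"
  shows "(\<Sum>k<length vs. real_of_int (cycle_sign vs es k) *\<^sub>R (arrow_vec (es ! k) :: real ^ 'n)) = 0"
proof -
  have "real_of_int (cycle_sign vs es k) *\<^sub>R arrow_vec (es ! k)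
      = (axis (vs ! k) 1 - axis (next_vertex vs k) 1 :: real ^ 'n)" if "k < length vs" for k
  proof -
    have "es ! k = (vs ! k, next_vertex vs k) \<or> es ! k = (next_vertex vs k, vs ! k)"
      using assms that by (auto simp: is_cycle_def)
    then show ?thesis using next_vertex_neq[OF assms that] by (auto simp: cycle_sign_def arrow_vec_def)
  qed
  then have "(\<Sum>k<length vs. real_of_int (cycle_sign vs es k) *\<^sub>R (arrow_vec (es ! k) :: real ^ 'n))
      = (\<Sum>k<length vs. axis (vs ! k) 1 - axis (next_vertex vs k) 1)"
    by (intro sum.cong) auto
  also have "\<dots> = 0"
    using sum_next_vertex[of "\<lambda>v. axis v 1 :: real ^ 'n" vs] by (simp add: sum_subtractf)
  finally show ?thesis .
qed

text \<open>The relation around the cycle, rewritten with coefficients indexed by vectors, which is the form in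
  which dependence is expressed.  The sum of the coefficients is kept because it decides affine
  dependence.\<close>

lemma cycle_int_relation:
  fixes A :: "('n::finite \<times> 'n) set"
  assumes "is_cycle A vs es" "irrefl A"
  obtains u :: "real ^ 'n \<Rightarrow> int" where
    "(\<Sum>v\<in>arrow_vec ` set es. real_of_int (u v) *\<^sub>R v) = 0"
    "\<forall>v. u v \<noteq> 0"
    "(\<Sum>v\<in>arrow_vec ` set es. u v) = (\<Sum>k<length vs. cycle_sign vs es k)"
proof -
  let ?f = "\<lambda>k. arrow_vec (es ! k) :: real ^ 'n"
  have len: "length es = length vs" and sub: "set es \<subseteq> A" using assms(1) by (auto simp: is_cycle_def)
  have inj: "inj_on ?f {..<length vs}"
  proof (rule inj_onI)
    fix j k assume jk: "j \<in> {..<length vs}" "k \<in> {..<length vs}" "?f j = ?f k"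
    then have "es ! j \<in> A" "es ! k \<in> A" using sub len by auto
    then have "es ! j = es ! k" using inj_onD[OF inj_on_arrow_vec[OF assms(2)]] jk(3) by blast
    then show "j = k"
      using nth_eq_iff_index_eq[OF cycle_arrows_distinct[OF assms(1)], of j k] jk len by simp
  qed
  have im: "arrow_vec ` set es = ?f ` {..<length vs}" using len by (auto simp: set_conv_nth)
  define u where "u v = cycle_sign vs es (inv_into {..<length vs} ?f v)" for v
  have u: "u (?f k) = cycle_sign vs es k" if "k < length vs" for k
    using inv_into_f_f[OF inj] that by (simp add: u_def)
  show thesis
  proof (rule that[of u])
    show "(\<Sum>v\<in>arrow_vec ` set es. real_of_int (u v) *\<^sub>R v) = 0"
      unfolding im using cycle_arrow_vec_relation[OF assms(1)] by (simp add: sum.reindex[OF inj] u)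
    show "\<forall>v. u v \<noteq> 0" by (simp add: u_def cycle_sign_def)
    show "(\<Sum>v\<in>arrow_vec ` set es. u v) = (\<Sum>k<length vs. cycle_sign vs es k)"
      unfolding im by (simp add: sum.reindex[OF inj] u)
  qed
qed

lemma cycle_int_dependent:
  assumes "is_cycle A vs es" "irrefl A"
  shows "int_module.dependent (arrow_vec ` set es)"
proof -
  obtain u :: "real ^ 'a \<Rightarrow> int" where u:
    "(\<Sum>v\<in>arrow_vec ` set es. real_of_int (u v) *\<^sub>R v) = 0" "\<forall>v. u v \<noteq> 0"
    by (rule cycle_int_relation[OF assms])
  have "es \<noteq> []" using assms(1) by (auto simp: is_cycle_def)
  then show ?thesis
    unfolding int_module.dependent_explicit using u
    by (intro exI[of _ "arrow_vec ` set es"] exI[of _ u]) (auto simp: ex_in_conv)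
qed

lemma homogeneous_cycle_affine_dependent:
  assumes "homogeneous_cycle A vs es" "irrefl A"
  shows "affine_dependent (arrow_vec ` set es)"
proof -
  have cyc: "is_cycle A vs es" using assms(1) by (simp add: homogeneous_cycle_def)
  obtain u :: "real ^ 'a \<Rightarrow> int" where u:
    "(\<Sum>v\<in>arrow_vec ` set es. real_of_int (u v) *\<^sub>R v) = 0" "\<forall>v. u v \<noteq> 0"
    "(\<Sum>v\<in>arrow_vec ` set es. u v) = (\<Sum>k<length vs. cycle_sign vs es k)"
    by (rule cycle_int_relation[OF cyc assms(2)])
  have "(\<Sum>v\<in>arrow_vec ` set es. real_of_int (u v)) = 0"
    unfolding of_int_sum[symmetric] u(3)
    using assms(1) homogeneous_cycle_iff_sum[OF cyc] by simp
  moreover have "es \<noteq> []" using cyc by (auto simp: is_cycle_def)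
  ultimately show ?thesis
    unfolding affine_dependent_explicit using u
    by (intro exI[of _ "arrow_vec ` set es"] exI[of _ "\<lambda>v. real_of_int (u v)"]) (auto simp: ex_in_conv)
qed

text \<open>Telescoping along a walk of arrows of \<open>T\<close>, in either direction, shows that all differences
  \<open>e\<^sub>u - e\<^sub>v\<close> lie in the span; with a fixed vertex \<open>r\<close>, a zero-sum vector \<open>x\<close> is the combination of the
  differences \<open>e\<^sub>i - e\<^sub>r\<close> with coefficients \<open>x\<^sub>i\<close>.\<close>

lemma int_span_connected:
  fixes T :: "('n::finite \<times> 'n) set"
  assumes "(T \<union> T\<inverse>)\<^sup>* = UNIV"
  shows "int_module.span (arrow_vec ` T) = (zero_sum_lattice :: (real ^ 'n) set)"
proof
  let ?S = "int_module.span (arrow_vec ` T) :: (real ^ 'n) set"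
  have "arrow_vec ` T \<subseteq> (zero_sum_lattice :: (real ^ 'n) set)"
    by (auto simp: zero_sum_lattice_def arrow_vec_def axis_def sum_subtractf)
  moreover have "int_module.subspace (zero_sum_lattice :: (real ^ 'n) set)"
    by (rule int_module.subspaceI)
      (auto simp: zero_sum_lattice_def sum.distrib sum_distrib_left[symmetric])
  ultimately show "?S \<subseteq> zero_sum_lattice" by (rule int_module.span_minimal)
  have connected: "axis u 1 - axis v 1 \<in> ?S" if "(u, v) \<in> (T \<union> T\<inverse>)\<^sup>*" for u v
    using that
  proof induction
    case base
    show ?case by (simp add: int_module.span_zero)
  next
    case (step v w)
    have "axis v 1 - axis w 1 \<in> ?S"
    proof (cases "(v, w) \<in> T")
      case True
      then show ?thesis by (metis arrow_vec_Pair image_eqI int_module.span_base)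
    next
      case False
      then have "(w, v) \<in> T" using step by auto
      then have "- (axis w 1 - axis v 1) \<in> ?S"
        by (metis arrow_vec_Pair image_eqI int_module.span_base int_module.span_neg)
      then show ?thesis by simp
    qed
    then have "(axis u 1 - axis v 1) + (axis v 1 - axis w 1) \<in> ?S"
      using step.IH by (rule int_module.span_add[rotated])
    then show ?case by simp
  qed
  show "zero_sum_lattice \<subseteq> ?S"
  proof
    fix x :: "real ^ 'n" assume x: "x \<in> zero_sum_lattice"
    fix r :: 'n
    define k where "k i = \<lfloor>x $ i\<rfloor>" for i
    have k: "real_of_int (k i) = x $ i" for i
      using x by (auto simp: k_def zero_sum_lattice_def of_int_floor)
    have "x = (\<Sum>i\<in>UNIV. (x $ i) *\<^sub>R axis i 1)"
      by (simp add: vec_eq_iff axis_def if_distrib cong: if_cong)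
    also have "\<dots> = (\<Sum>i\<in>UNIV. (x $ i) *\<^sub>R axis i 1) - (\<Sum>i\<in>UNIV. x $ i) *\<^sub>R axis r 1"
      using x by (simp add: zero_sum_lattice_def)
    also have "\<dots> = (\<Sum>i\<in>UNIV. real_of_int (k i) *\<^sub>R (axis i 1 - axis r 1))"
      by (simp add: k scaleR_sum_left scaleR_diff_right sum_subtractf)
    also have "\<dots> \<in> ?S"
      using assms by (intro int_module.span_sum int_module.span_scale connected) auto
    finally show "x \<in> ?S" .
  qed
qed

section \<open>Facets and distance-bounded cycles\<close>

definition distance_bounded_cycle :: "('n \<times> 'n) set \<Rightarrow> 'n list \<Rightarrow> ('n \<times> 'n) list \<Rightarrow> bool" where
  "distance_bounded_cycle A vs es \<longleftrightarrow> homogeneous_cycle A vs es \<and>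
     (\<forall>a < length vs. \<forall>b < length vs.
        ereal (real (cycle_mu vs es (vs ! a)) - real (cycle_mu vs es (vs ! b)))
          \<le> ereal_of_enat (digraph_dist A (vs ! a) (vs ! b)))"

text \<open>On the cycle \<open>\<mu>\<close> and \<open>a\<close> have the same differences, and those of \<open>a\<close> are bounded by the distance
  since \<open>a\<close> drops by at most one per arrow.\<close>

lemma tight_cycle_distance_bounded:
  assumes "is_cycle (tight_arrows A a) vs es" "subpotential A (($) a)"
  shows "distance_bounded_cycle A vs es"
proof -
  have pot: "cycle_potential vs es (($) a)" by (rule tight_cycle_potential[OF assms(1)])
  have "is_cycle A vs es"
    using assms(1) by (rule is_cycle_mono) (auto simp: tight_arrows_def)
  then have hom: "homogeneous_cycle A vs es" using pot by (rule homogeneous_cycleI)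
  have "ereal (real (cycle_mu vs es (vs ! p)) - real (cycle_mu vs es (vs ! q)))
      \<le> ereal_of_enat (digraph_dist A (vs ! p) (vs ! q))" if "p < length vs" "q < length vs" for p q
    using cycle_potential_diff_unique[OF cycle_mu_is_potential[OF hom] pot, of "vs ! p" "vs ! q"]
      subpotential_le_dist[OF assms(2), of "vs ! p" "vs ! q"] that by simp
  then show ?thesis using hom by (simp add: distance_bounded_cycle_def)
qed

text \<open>The tight arrows of a facet connect all the vertices and contain no cycle, so they are a spanning
  tree; its arrow vectors are independent and generate the lattice.\<close>

lemma facet_unimodular_simplex_if_no_bounded_cycle:
  fixes A :: "('n::finite \<times> 'n) set"
  assumes strong: "A\<^sup>* = UNIV" and irr: "irrefl A"
    and facet: "F facet_of digraph_polytope A"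
    and none: "\<not> (\<exists>vs es. distance_bounded_cycle A vs es)"
  shows "(\<exists>k. k simplex F) \<and> int_basis_of {v. v extreme_point_of F} zero_sum_lattice"
proof -
  obtain a where sub: "subpotential A (($) a)" and F: "F = level_face A a"
    using facet_is_level_face[OF strong facet] by blast
  let ?T = "tight_arrows A a"
  have asym: "(j, i) \<notin> ?T" if "(i, j) \<in> ?T" for i j
    using that by (auto simp: tight_arrows_def)
  have "e \<notin> ((?T - {e}) \<union> (?T - {e})\<inverse>)\<^sup>*" if "e \<in> ?T" for e
  proof
    assume "e \<in> ((?T - {e}) \<union> (?T - {e})\<inverse>)\<^sup>*"
    then have "\<exists>vs es. is_cycle ?T vs es"
      using cycle_if_not_bridge[OF asym, of "fst e" "snd e"] that by simp
    then show False using none tight_cycle_distance_bounded[OF _ sub] by blast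
  qed
  then have indep: "independent (arrow_vec ` ?T :: (real ^ 'n) set)"
    by (rule independent_if_all_bridges)
  have "int_module.span (arrow_vec ` ?T) = (zero_sum_lattice :: (real ^ 'n) set)"
    using facet_tight_connected[OF strong irr sub] facet by (intro int_span_connected) (simp add: F)
  then have "int_basis_of (arrow_vec ` ?T) (zero_sum_lattice :: (real ^ 'n) set)"
    using int_independent_if_independent[OF indep] by (simp add: int_basis_of_def)
  moreover have "(int (card (arrow_vec ` ?T :: (real ^ 'n) set)) - 1) simplex F"
    unfolding F level_face_eq_convex_hull[OF irr sub]
    using indep affine_dependent_imp_dependent by (intro simplex_convex_hull) auto
  ultimately show ?thesis unfolding F extreme_points_level_face[OF irr sub] by blast
qed

text \<open>The extension of \<open>\<mu>\<close> to all the vertices makes every arrow of the cycle tight, so the cycle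
  contributes a dependent set to the vertices of a proper face, and hence of every facet above it.\<close>

lemma bad_facet_if_bounded_cycle:
  fixes A :: "('n::finite \<times> 'n) set"
  assumes strong: "A\<^sup>* = UNIV" and irr: "irrefl A" and bounded: "distance_bounded_cycle A vs es"
  shows "\<exists>F. F facet_of digraph_polytope A \<and> \<not> (\<exists>k. k simplex F) \<and>
    \<not> int_basis_of {v. v extreme_point_of F} zero_sum_lattice"
proof -
  let ?\<mu> = "\<lambda>v. real (cycle_mu vs es v)"
  have hom: "homogeneous_cycle A vs es" using bounded by (simp add: distance_bounded_cycle_def)
  have cyc: "is_cycle A vs es" using hom by (simp add: homogeneous_cycle_def)
  have ne: "vs \<noteq> []" "es \<noteq> []" and esA: "set es \<subseteq> A" using cyc by (auto simp: is_cycle_def)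
  have "ereal (?\<mu> u - ?\<mu> v) \<le> ereal_of_enat (digraph_dist A u v)" if "u \<in> set vs" "v \<in> set vs" for u v
    using that bounded by (auto simp: distance_bounded_cycle_def in_set_conv_nth)
  then obtain f where f: "subpotential A f" "\<forall>v\<in>set vs. f v = ?\<mu> v"
    using subpotential_extension[OF strong, of "set vs" ?\<mu>] ne by auto
  define a where "a = (\<chi> v. f v)"
  have sub: "subpotential A (($) a)" using f(1) by (simp add: a_def subpotential_def)
  have tight: "set es \<subseteq> tight_arrows A a"
  proof
    fix e assume e: "e \<in> set es"
    then obtain k where k: "k < length vs" "e = es ! k"
      using cyc by (auto simp: is_cycle_def in_set_conv_nth)
    have "?\<mu> (vs ! k) - ?\<mu> (next_vertex vs k) = of_int (cycle_sign vs es k)"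
      using cycle_mu_is_potential[OF hom] k(1) by (simp add: cycle_potential_def)
    then have "a $ (vs ! k) - a $ next_vertex vs k = of_int (cycle_sign vs es k)"
      using f(2) k(1) next_vertex_in_set[OF k(1)] by (simp add: a_def)
    moreover have "e = (vs ! k, next_vertex vs k) \<or> e = (next_vertex vs k, vs ! k)"
      using cyc k by (auto simp: is_cycle_def)
    ultimately have "a \<bullet> arrow_vec e = 1"
      using next_vertex_neq[OF cyc k(1)] k(2) by (auto simp: cycle_sign_def)
    then show "e \<in> tight_arrows A a" using e esA by (auto simp: tight_arrows_def)
  qed
  have "A \<noteq> {}" using esA ne by auto
  have "hd es \<in> tight_arrows A a" using tight ne by auto
  then have "arrow_vec (hd es) \<in> level_face A a"
    using arrow_vec_in_polytope[of "hd es" A]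
    by (auto simp: level_face_def tight_arrows_def simp del: inner_arrow_vec)
  then have "level_face A a \<noteq> {}" by blast
  then obtain F where F: "F facet_of digraph_polytope A" "level_face A a \<subseteq> F"
    using face_of_polyhedron_subset_facet[OF polytope_imp_polyhedron[OF polytope_digraph_polytope]
        level_face_is_face[OF sub]] level_face_proper[OF strong \<open>A \<noteq> {}\<close>] by metis
  let ?E = "{v. v extreme_point_of F}"
  have sub_E: "arrow_vec ` set es \<subseteq> ?E"
  proof
    fix v :: "real ^ 'n" assume "v \<in> arrow_vec ` set es"
    then have "v extreme_point_of level_face A a"
      using tight extreme_points_level_face[OF irr sub] by blast
    moreover have "level_face A a face_of F"
      using face_of_subset[OF level_face_is_face[OF sub] F(2)] facet_of_imp_subset[OF F(1)] by blast
    ultimately show "v \<in> ?E" using extreme_point_of_face by blast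
  qed
  have "\<not> k simplex F" for k
  proof
    assume "k simplex F"
    then obtain C where C: "\<not> affine_dependent C" "F = convex hull C" by (auto simp: simplex_def)
    then have "?E = C" using extreme_point_of_convex_hull_affine_independent[OF C(1)] by blast
    then show False
      using affine_dependent_subset[OF homogeneous_cycle_affine_dependent[OF hom irr] sub_E] C(1) by simp
  qed
  moreover have "\<not> int_basis_of ?E zero_sum_lattice"
    using int_module.dependent_mono[OF cycle_int_dependent[OF cyc irr] sub_E]
    by (simp add: int_basis_of_def)
  ultimately show ?thesis using F(1) by blast
qed

theorem theorem2p2:
  fixes A :: "('n::finite \<times> 'n) set"
  assumes "CARD('n) \<ge> 2"
    and "irrefl A"
    and "underlying_connected A"
    and "\<forall>a\<in>A. \<exists>vs es. directed_cycle A vs es \<and> a \<in> set es"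
  shows "(simplicial_polytope (digraph_polytope A) \<longleftrightarrow>
            smooth_polytope zero_sum_lattice (digraph_polytope A)) \<and>
         (smooth_polytope zero_sum_lattice (digraph_polytope A) \<longleftrightarrow>
            \<not> (\<exists>vs es. homogeneous_cycle A vs es \<and>
                 (\<forall>a < length vs. \<forall>b < length vs.
                    ereal (real (cycle_mu vs es (vs ! a)) - real (cycle_mu vs es (vs ! b)))
                      \<le> ereal_of_enat (digraph_dist A (vs ! a) (vs ! b)))))"
  unfolding distance_bounded_cycle_def[symmetric]
proof -
  have strong: "A\<^sup>* = UNIV" using assms(3,4) by (rule strongly_connected)
  show "(simplicial_polytope (digraph_polytope A) \<longleftrightarrow>
            smooth_polytope zero_sum_lattice (digraph_polytope A)) \<and>
         (smooth_polytope zero_sum_lattice (digraph_polytope A) \<longleftrightarrow>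
            \<not> (\<exists>vs es. distance_bounded_cycle A vs es))"
  proof (cases "\<exists>vs es. distance_bounded_cycle A vs es")
    case True
    then show ?thesis
      using bad_facet_if_bounded_cycle[OF strong assms(2)]
      unfolding simplicial_polytope_def smooth_polytope_def by blast
  next
    case False
    then show ?thesis
      using facet_unimodular_simplex_if_no_bounded_cycle[OF strong assms(2) _ False]
      unfolding simplicial_polytope_def smooth_polytope_def by blast
  qed
qed

end
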